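(* Let $(\Omega,\mathcal{F},\mathbb{P})$ be a probability space and $L^0=L^0(\Omega,\mathcal{F},\mathbb{P})$. Let $E$ be a set, let $\varepsilon\in L^0_{++}$, and let $\{f_n\}_{n\in\mathbb{N}}$ be a sequence of functions $f_n:E\to B_\varepsilon$, where $B_\varepsilon=\{Y\in L^0 : |Y|\le\varepsilon\}$. Let $S$ be a subset of $E$ such that for every sequence $\{Y_n\}_{n\in\mathbb{N}}$ in $L^0_{++}$ with $\sum_{n\ge 1}Y_n=1$ there exists $Z\in S$ such that \[ \operatorname*{ess\,sup}_{X\in E}\ \sum_{n\ge 1}Y_n f_n(X)=\sum_{n\ge 1}Y_n f_n(Z). \] Then \[ \operatorname*{ess\,sup}_{X\in S}\ \operatorname*{ess\,lim\,sup}_{n\to\infty} f_n(X)\ \ge\ \operatorname*{ess\,inf}_{f\in \mathrm{co}_{L^0}(\{f_n:\,n\in\mathbb{N}\})}\ \operatorname*{ess\,sup}_{X\in E} f(X). \]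
   Context: $\mathbb{N}=\{1,2,\dots\}$. $L^0$ is the set of equivalence classes (modulo almost sure equality) of real-valued $\mathcal{F}$-measurable random variables, a ring under pointwise operations. $\bar L^0$ is the analogous set of classes of $\mathcal{F}$-measurable random variables with values in $\mathbb{R}\cup\{\pm\infty\}$. For $X,Y$ in $L^0$ or $\bar L^0$, $X\ge Y$ means $\mathbb{P}(X\ge Y)=1$ and $X>Y$ means $\mathbb{P}(X>Y)=1$. Put $L^0_+=\{Y\in L^0: Y\ge 0\}$ and $L^0_{++}=\{Y\in L^0: Y>0\}$ (so $Y>0$ almost surely). Equalities and inequalities between random variables are in the almost sure sense, and infinite sums of random variables are almost sure pointwise sums. Essential supremum and infimum: for $\phi\subset L^0$, $\operatorname{ess\,sup}\phi$ is the least upper bound of $\phi$ in $\bar L^0$ for the order $\ge$, i.e. the unique $Y^*\in\bar L^0$ with $Y^*\ge Y$ for all $Y\in\phi$ and $Y'\ge Y^*$ for every other $Y'\in\bar L^0$ with this property; it always exists. One writes $\operatorname{ess\,sup}_{Y\in\phi}Y$ for it, and $\operatorname{ess\,inf}_{Y\in\phi}Y:=-\operatorname{ess\,sup}_{Y\in\phi}(-Y)$. For a sequence $\{Y_n\}$ in $L^0$, $\operatorname{ess\,lim\,sup}_{n\to\infty}Y_n:=\operatorname{ess\,inf}_{n}\operatorname{ess\,sup}_{m\ge n}Y_m$. $L^0$-convex hull: for a subset $T$ of an $L^0$-module, \[ \mathrm{co}_{L^0}(T):=\Big\{\sum_{i\in I}Y_iX_i : I \text{ finite},\ X_i\in T,\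 Y_i\in L^0_+,\ \sum_{i\in I}Y_i=1\Big\}. \] Here it is applied to $T=\{f_n:n\in\mathbb{N}\}$ in the $L^0$-module of all functions $E\to L^0$ with pointwise operations. *)

theory Defs
  imports "HOL-Probability.Probability"
begin

text \<open>
  Elements of $L^0$ and $\bar L^0$ are represented by measurable functions, and every relation
  between them is stated almost everywhere.
  The notions below respect almost sure equality of representatives.
\<close>

definition L0 :: "'a measure \<Rightarrow> ('a \<Rightarrow> real) set" where
  "L0 M = borel_measurable M"

definition L0bar :: "'a measure \<Rightarrow> ('a \<Rightarrow> ereal) set" where
  "L0bar M = borel_measurable M"

definition L0_nonneg :: "'a measure \<Rightarrow> ('a \<Rightarrow> real) set" where
  "L0_nonneg M = {Y \<in> L0 M. AE \<omega> in M. Y \<omega> \<ge> 0}"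

definition L0_pos :: "'a measure \<Rightarrow> ('a \<Rightarrow> real) set" where
  "L0_pos M = {Y \<in> L0 M. AE \<omega> in M. Y \<omega> > 0}"

definition L0_ball :: "'a measure \<Rightarrow> ('a \<Rightarrow> real) \<Rightarrow> ('a \<Rightarrow> real) set" where
  "L0_ball M \<epsilon> = {Y \<in> L0 M. AE \<omega> in M. \<bar>Y \<omega>\<bar> \<le> \<epsilon> \<omega>}"

text \<open>
  Families in $\bar L^0$ rather than only in $L^0$ are allowed, because the essential limit superior
  and the two sides of the inequality iterate the operations.
\<close>

definition is_ess_sup :: "'a measure \<Rightarrow> ('a \<Rightarrow> ereal) set \<Rightarrow> ('a \<Rightarrow> ereal) \<Rightarrow> bool" where
  "is_ess_sup M \<Phi> Y \<longleftrightarrow> Y \<in> L0bar M \<and> (\<forall>X\<in>\<Phi>. AE \<omega> in M. Y \<omega> \<ge> X \<omega>) \<and>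
     (\<forall>Y'\<in>L0bar M. (\<forall>X\<in>\<Phi>. AE \<omega> in M. Y' \<omega> \<ge> X \<omega>) \<longrightarrow> (AE \<omega> in M. Y' \<omega> \<ge> Y \<omega>))"

text \<open>
  Choice only selects a representative: see \<open>is_ess_sup_ess_sup\<close> and \<open>is_ess_sup_unique\<close> below.
\<close>

definition ess_sup :: "'a measure \<Rightarrow> ('a \<Rightarrow> ereal) set \<Rightarrow> 'a \<Rightarrow> ereal" where
  "ess_sup M \<Phi> = (SOME Y. is_ess_sup M \<Phi> Y)"

definition ess_inf :: "'a measure \<Rightarrow> ('a \<Rightarrow> ereal) set \<Rightarrow> 'a \<Rightarrow> ereal" where
  "ess_inf M \<Phi> = (\<lambda>\<omega>. - ess_sup M ((\<lambda>Y \<omega>. - Y \<omega>) ` \<Phi>) \<omega>)"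

definition ess_limsup :: "'a measure \<Rightarrow> (nat \<Rightarrow> 'a \<Rightarrow> ereal) \<Rightarrow> 'a \<Rightarrow> ereal" where
  "ess_limsup M Y = ess_inf M (range (\<lambda>n. ess_sup M (Y ` {n..})))"

definition L0_convex_hull ::
    "'a measure \<Rightarrow> ('e \<Rightarrow> 'a \<Rightarrow> real) set \<Rightarrow> ('e \<Rightarrow> 'a \<Rightarrow> real) set" where
  "L0_convex_hull M T = {(\<lambda>x \<omega>. \<Sum>i\<in>I. Y i \<omega> * g i x \<omega>) | (I :: nat set) Y g.
     finite I \<and> (\<forall>i\<in>I. g i \<in> T) \<and> (\<forall>i\<in>I. Y i \<in> L0_nonneg M) \<and>
     (AE \<omega> in M. (\<Sum>i\<in>I. Y i \<omega>) = 1)}"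

lemma is_ess_sup_unique:
  assumes "is_ess_sup M \<Phi> Y" "is_ess_sup M \<Phi> Y'"
  shows "AE \<omega> in M. Y \<omega> = Y' \<omega>"
proof -
  have "AE \<omega> in M. Y \<omega> \<le> Y' \<omega>" "AE \<omega> in M. Y' \<omega> \<le> Y \<omega>"
    using assms unfolding is_ess_sup_def by blast+
  then show ?thesis by eventually_elim auto
qed

lemma is_ess_sup_exists:
  assumes "prob_space M" and \<Phi>: "\<Phi> \<subseteq> L0bar M"
  shows "\<exists>Y. is_ess_sup M \<Phi> Y"
proof -
  interpret prob_space M by fact
  define h :: "ereal \<Rightarrow> real" where
    "h x = (if x = \<infinity> then pi/2 else if x = -\<infinity> then -pi/2 else arctan (real_of_ereal x))" for x
  have [measurable]: "arctan \<in> borel_measurable borel"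
    by (intro borel_measurable_continuous_onI continuous_intros)
  have [measurable]: "h \<in> borel_measurable borel"
    unfolding h_def by measurable
  have h_bd: "\<bar>h x\<bar> \<le> 2" for x
    using arctan_bounded[of "real_of_ereal x"] pi_less_4 pi_gt_zero by (auto simp: h_def abs_if)
  have h_less: "h x < h y" if "x < y" for x y
    using that arctan_bounded by (cases x; cases y) (auto simp: h_def arctan_less_iff)
  have h_mono: "h x \<le> h y" if "x \<le> y" for x y
    using h_less[of x y] that by (cases "x = y") (auto simp: order.order_iff_strict)
  define S where "S C = (\<lambda>\<omega>. SUP X\<in>C. X \<omega>)" for C :: "('a \<Rightarrow> ereal) set"
  have S_meas: "S C \<in> borel_measurable M" if "countable C" "C \<subseteq> \<Phi>" for C
    unfolding S_def using that \<Phi> by (intro borel_measurable_SUP) (auto simp: L0bar_def)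
  define J where "J C = (\<integral>\<omega>. h (S C \<omega>) \<partial>M)" for C
  define \<C> where "\<C> = {C. countable C \<and> C \<subseteq> \<Phi>}"
  have int: "integrable M (\<lambda>\<omega>. h (S C \<omega>))" if "C \<in> \<C>" for C
  proof -
    have [measurable]: "S C \<in> borel_measurable M" using S_meas that by (auto simp: \<C>_def)
    show ?thesis using h_bd by (intro integrable_const_bound[where B=2]) auto
  qed
  have J_mono: "J C \<le> J D" if "C \<in> \<C>" "D \<in> \<C>" "C \<subseteq> D" for C D
    unfolding J_def using that
    by (intro integral_mono int h_mono) (auto simp: S_def intro: SUP_subset_mono)
  have "J C \<le> (\<integral>\<omega>. 2 \<partial>M)" if "C \<in> \<C>" for C
    unfolding J_def using that h_bd by (intro integral_mono int) (auto simp: abs_le_iff)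
  then have bdd: "bdd_above (J ` \<C>)" by (intro bdd_aboveI2)
  have ne: "\<C> \<noteq> {}" by (auto simp: \<C>_def)
  define s where "s = (SUP C\<in>\<C>. J C)"
  have "\<exists>C\<in>\<C>. s - 1 / Suc n < J C" for n
    using less_cSUP_iff[OF ne bdd, of "s - 1 / Suc n"] by (auto simp: s_def)
  then obtain c where c: "\<And>n. c n \<in> \<C>" "\<And>n. s - 1 / Suc n < J (c n)" by metis
  define D where "D = (\<Union>n. c n)"
  have D: "D \<in> \<C>" using c(1) by (auto simp: D_def \<C>_def)
  have sD: "s \<le> J D"
  proof (rule field_le_epsilon)
    fix e :: real assume "e > 0"
    then obtain n where "1 / Suc n < e" using reals_Archimedean[of e] by (auto simp: inverse_eq_divide)
    moreover have "J (c n) \<le> J D" using c(1) D by (intro J_mono) (auto simp: D_def)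
    ultimately show "s \<le> J D + e" using c(2)[of n] by linarith
  qed
  have "AE \<omega> in M. X \<omega> \<le> S D \<omega>" if X: "X \<in> \<Phi>" for X
  proof -
    have iD: "insert X D \<in> \<C>" using D X by (auto simp: \<C>_def)
    have le: "h (S D \<omega>) \<le> h (S (insert X D) \<omega>)" for \<omega>
      by (intro h_mono) (auto simp: S_def intro: SUP_subset_mono)
    have "J (insert X D) \<le> s" unfolding s_def using bdd iD by (intro cSUP_upper)
    with sD J_mono[OF D iD subset_insertI] have "J (insert X D) = J D" by linarith
    then have "(\<integral>\<omega>. h (S (insert X D) \<omega>) - h (S D \<omega>) \<partial>M) = 0"
      using int[OF D] int[OF iD] by (simp add: J_def)
    then have "AE \<omega> in M. h (S (insert X D) \<omega>) - h (S D \<omega>) = 0"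
      using int[OF D] int[OF iD] le by (subst (asm) integral_nonneg_eq_0_iff_AE) auto
    then show ?thesis
    proof eventually_elim
      case (elim \<omega>)
      have "X \<omega> \<le> S (insert X D) \<omega>" by (auto simp: S_def)
      moreover have "\<not> S D \<omega> < S (insert X D) \<omega>" using h_less elim by fastforce
      ultimately show ?case by auto
    qed
  qed
  moreover have "AE \<omega> in M. S D \<omega> \<le> Y' \<omega>" if "\<forall>X\<in>\<Phi>. AE \<omega> in M. X \<omega> \<le> Y' \<omega>" for Y'
  proof -
    have "AE \<omega> in M. \<forall>X\<in>D. X \<omega> \<le> Y' \<omega>"
      using D that by (subst AE_ball_countable) (auto simp: \<C>_def)
    then show ?thesis by eventually_elim (auto simp: S_def SUP_le_iff)
  qed
  ultimately have "is_ess_sup M \<Phi> (S D)"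
    using D S_meas by (auto simp: is_ess_sup_def L0bar_def \<C>_def)
  then show ?thesis by blast
qed

lemma is_ess_sup_ess_sup:
  assumes "prob_space M" "\<Phi> \<subseteq> L0bar M"
  shows "is_ess_sup M \<Phi> (ess_sup M \<Phi>)"
  unfolding ess_sup_def using is_ess_sup_exists[OF assms] by (rule someI_ex)

end

theory Submission
  imports Defs
begin

text \<open>
  This is Simons' inequality with random coefficients, and the proof randomises the classical one.
  A weight is a sequence \<open>a\<close> of nonnegative random variables, \<open>mix a x\<close> is the weighted sum of the
  values \<open>f j x\<close>, and \<open>top_value a\<close> is the essential supremum of \<open>mix a x\<close> over \<open>x \<in> E\<close>.

  Partial weights \<open>B n\<close> of total mass \<open>1 - (1/2)^n\<close> are built greedily by
  \<open>B (n+1) = B n + (1/2)^(n+1) * w n\<close>, where the probability weight \<open>w n\<close> uses only indices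
  from \<open>n\<close> on and almost minimises the size of \<open>top_value (B n + (1/2)^n * w)\<close>. Write
  \<open>G n = B n + (1/2)^n * w n\<close>. The average of \<open>w n\<close> and \<open>w (n+1)\<close> competes with \<open>w n\<close> and turns
  \<open>G n\<close> into \<open>G (n+1)\<close>, so \<open>top_value (G n)\<close> is essentially increasing in \<open>n\<close>, and it is
  essentially dominated by \<open>top_value h\<close> for the limit \<open>h\<close> of the \<open>B n\<close>. By hypothesis
  \<open>top_value h\<close> is attained at some \<open>z \<in> S\<close>. Since \<open>G n = 2 * B (n+1) - B n\<close>, evaluating at \<open>z\<close>
  says that the tail averages \<open>2^n * (mix h z - mix (B n) z)\<close> essentially increase with \<open>n\<close>; they
  start at \<open>mix h z = top_value h\<close>, which is essentially at least \<open>top_value (w 0)\<close>, hence at least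
  the right-hand side of the claim. The \<open>n\<close>-th tail average is a convex combination of the values
  \<open>f j z\<close> with \<open>j \<ge> n\<close>, so the limit superior at \<open>z\<close> is at least this number
  (\<open>tail_averages_lower_bound\<close>, \<open>approximate_inequality\<close>).

  What is specific to random variables is the meaning of ``almost minimises''. Approaching an
  essential infimum uniformly would in general require gluing countably many weights together, which leaves the
  convex hull of finite combinations. Instead the mean of \<open>top_value / \<epsilon>\<close> is almost minimised, a
  real number. Choosing between two competitors on an event and its complement stays inside the hull,
  and this upgrades minimality of the mean to a bound on the mean of the positive part of
  \<open>top_value (G n) - top_value (G (n+1))\<close> (\<open>excess_bound\<close>). The price is an
  error that is a random variable \<open>D\<close> with small mean of \<open>D / \<epsilon>\<close> rather than a small constant; such
  errors vanish almost surely in the end (\<open>AE_le_of_small_errors\<close>).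
\<close>

section \<open>Essential suprema and infima\<close>

lemma (in prob_space)
  assumes "\<Phi> \<subseteq> L0bar M"
  shows ess_sup_L0bar: "ess_sup M \<Phi> \<in> L0bar M"
    and ess_sup_upper: "X \<in> \<Phi> \<Longrightarrow> AE \<omega> in M. X \<omega> \<le> ess_sup M \<Phi> \<omega>"
    and ess_sup_least: "Y \<in> L0bar M \<Longrightarrow> (\<And>X. X \<in> \<Phi> \<Longrightarrow> AE \<omega> in M. X \<omega> \<le> Y \<omega>)
      \<Longrightarrow> AE \<omega> in M. ess_sup M \<Phi> \<omega> \<le> Y \<omega>"
  using is_ess_sup_ess_sup[OF prob_space_axioms assms] unfolding is_ess_sup_def by blast+

lemma (in prob_space)
  assumes \<Phi>: "\<Phi> \<subseteq> L0bar M"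
  shows ess_inf_L0bar: "ess_inf M \<Phi> \<in> L0bar M"
    and ess_inf_lower: "X \<in> \<Phi> \<Longrightarrow> AE \<omega> in M. ess_inf M \<Phi> \<omega> \<le> X \<omega>"
    and ess_inf_greatest: "Y \<in> L0bar M \<Longrightarrow> (\<And>X. X \<in> \<Phi> \<Longrightarrow> AE \<omega> in M. Y \<omega> \<le> X \<omega>)
      \<Longrightarrow> AE \<omega> in M. Y \<omega> \<le> ess_inf M \<Phi> \<omega>"
proof -
  let ?N = "(\<lambda>Y \<omega>. - Y \<omega>) ` \<Phi>"
  have N: "?N \<subseteq> L0bar M" using \<Phi> by (auto simp: L0bar_def)
  show "ess_inf M \<Phi> \<in> L0bar M"
    using ess_sup_L0bar[OF N] by (auto simp: ess_inf_def L0bar_def)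
  show "AE \<omega> in M. ess_inf M \<Phi> \<omega> \<le> X \<omega>" if "X \<in> \<Phi>"
  proof -
    have "AE \<omega> in M. - X \<omega> \<le> ess_sup M ?N \<omega>" using that by (intro ess_sup_upper[OF N]) auto
    then show ?thesis by eventually_elim (auto simp: ess_inf_def ereal_uminus_le_reorder)
  qed
  show "AE \<omega> in M. Y \<omega> \<le> ess_inf M \<Phi> \<omega>"
    if Y: "Y \<in> L0bar M" and le: "\<And>X. X \<in> \<Phi> \<Longrightarrow> AE \<omega> in M. Y \<omega> \<le> X \<omega>"
  proof -
    have "AE \<omega> in M. ess_sup M ?N \<omega> \<le> - Y \<omega>"
      using Y le by (intro ess_sup_least[OF N]) (auto simp: L0bar_def)
    then show ?thesis by eventually_elim (simp add: ess_inf_def, metis ereal_minus_le_minus ereal_uminus_uminus)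
  qed
qed

text \<open>
  A null set may be discarded for each of the countably many indices, so an essential limit
  superior dominates everything that lies almost surely below all tail suprema.
\<close>

lemma (in prob_space) ess_limsup_greatest:
  assumes Y: "\<And>n. Y n \<in> L0bar M" and V: "V \<in> L0bar M"
    and le: "AE \<omega> in M. \<forall>n K. (\<forall>j\<ge>n. Y j \<omega> \<le> K) \<longrightarrow> V \<omega> \<le> K"
  shows "AE \<omega> in M. V \<omega> \<le> ess_limsup M Y \<omega>"
  unfolding ess_limsup_def
proof (rule ess_inf_greatest)
  have sub: "Y ` {n..} \<subseteq> L0bar M" for n using Y by auto
  show "range (\<lambda>n. ess_sup M (Y ` {n..})) \<subseteq> L0bar M" using ess_sup_L0bar[OF sub] by auto
  show "V \<in> L0bar M" by fact
  fix X assume "X \<in> range (\<lambda>n. ess_sup M (Y ` {n..}))"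
  then obtain n where X: "X = ess_sup M (Y ` {n..})" by auto
  have "AE \<omega> in M. j \<ge> n \<longrightarrow> Y j \<omega> \<le> X \<omega>" for j
    using ess_sup_upper[OF sub, of "Y j" n] X by (cases "j \<ge> n") auto
  then have "AE \<omega> in M. \<forall>j. j \<ge> n \<longrightarrow> Y j \<omega> \<le> X \<omega>" by (subst AE_all_countable) auto
  with le show "AE \<omega> in M. V \<omega> \<le> X \<omega>" by eventually_elim blast
qed

lemma (in prob_space) ess_limsup_L0bar:
  assumes "\<And>n. Y n \<in> L0bar M"
  shows "ess_limsup M Y \<in> L0bar M"
proof -
  have sub: "Y ` {n..} \<subseteq> L0bar M" for n using assms by auto
  show ?thesis unfolding ess_limsup_def
    by (intro ess_inf_L0bar) (use ess_sup_L0bar[OF sub] in auto)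
qed

section \<open>Weights and mixtures\<close>

lemma weighted_sum_bound:
  fixes a u :: "nat \<Rightarrow> real"
  assumes a: "\<And>j. 0 \<le> a j" "a sums s" and u: "\<And>j. \<bar>u j\<bar> \<le> e"
  shows "summable (\<lambda>j. a j * u j)" and "\<bar>\<Sum>j. a j * u j\<bar> \<le> s * e"
proof -
  have se: "(\<lambda>j. a j * e) sums (s * e)" using a(2) by (rule sums_mult2)
  have b: "norm (a j * u j) \<le> a j * e" for j
    using a(1) u by (auto simp: abs_mult intro: mult_left_mono)
  show "summable (\<lambda>j. a j * u j)"
    using sums_summable[OF se] b by (rule summable_comparison_test'[where N=0])
  have "norm (\<Sum>j. a j * u j) \<le> (\<Sum>j. a j * e)"
    using b sums_summable[OF se] by (rule norm_suminf_le)
  then show "\<bar>\<Sum>j. a j * u j\<bar> \<le> s * e" using sums_unique[OF se] by simp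
qed

text \<open>
  The bound is extended real because it is applied to suprema of infinitely many values; as \<open>K\<close> lies
  above the real number \<open>u n\<close>, only real \<open>K\<close> needs an argument.
\<close>

lemma weighted_average_le:
  fixes a u :: "nat \<Rightarrow> real" and K :: ereal
  assumes a: "\<And>j. 0 \<le> a j" "a sums 1" "\<And>j. j < n \<Longrightarrow> a j = 0" and u: "\<And>j. \<bar>u j\<bar> \<le> e"
    and K: "\<And>j. j \<ge> n \<Longrightarrow> ereal (u j) \<le> K"
  shows "ereal (\<Sum>j. a j * u j) \<le> K"
proof (cases K)
  case (real k)
  have se: "(\<lambda>j. a j * k) sums (1 * k)" using a(2) by (rule sums_mult2)
  have "a j * u j \<le> a j * k" for j
    using a(1)[of j] a(3)[of j] K[of j] real by (cases "j < n") (auto intro: mult_left_mono)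
  then have "(\<Sum>j. a j * u j) \<le> (\<Sum>j. a j * k)"
    using weighted_sum_bound(1)[OF a(1,2) u] sums_summable[OF se] by (intro suminf_le) auto
  then show ?thesis using sums_unique[OF se] real by simp
qed (use K[of n] in auto)

text \<open>
  Nonnegativity and the total mass are required at every point instead of almost everywhere. This loses
  nothing for the constructions here, and keeps all identities between weights free of null sets; only
  the values of \<open>f\<close> need them.
\<close>

definition weights :: "'a measure \<Rightarrow> real \<Rightarrow> (nat \<Rightarrow> 'a \<Rightarrow> real) set" where
  "weights M s = {a. (\<forall>j. a j \<in> borel_measurable M) \<and> (\<forall>j \<omega>. 0 \<le> a j \<omega>) \<and>
     (\<forall>\<omega>. (\<lambda>j. a j \<omega>) sums s)}"

text \<open>
  The competitors for \<open>w n\<close>. Finite support places them in the convex hull of the \<open>f j\<close>.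
  Positivity at the first index makes every coefficient of the limiting weight strictly positive, as
  the attainment hypothesis demands. It survives the operations used on competitors, so it can be
  built into the class over which the minimisation runs.
\<close>

definition head_weights :: "'a measure \<Rightarrow> nat \<Rightarrow> (nat \<Rightarrow> 'a \<Rightarrow> real) set" where
  "head_weights M n = {w \<in> weights M 1. (\<forall>j<n. \<forall>\<omega>. w j \<omega> = 0) \<and> (\<forall>\<omega>. 0 < w n \<omega>) \<and>
     (\<exists>N. \<forall>j\<ge>N. \<forall>\<omega>. w j \<omega> = 0)}"

definition add_scaled :: "(nat \<Rightarrow> 'a \<Rightarrow> real) \<Rightarrow> real \<Rightarrow> (nat \<Rightarrow> 'a \<Rightarrow> real) \<Rightarrow> nat \<Rightarrow> 'a \<Rightarrow> real" where
  "add_scaled a c b = (\<lambda>j \<omega>. a j \<omega> + c * b j \<omega>)"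

lemma weights_add_scaled:
  assumes "a \<in> weights M s" "b \<in> weights M t" "0 \<le> c" "r = s + c * t"
  shows "add_scaled a c b \<in> weights M r"
  using assms unfolding weights_def add_scaled_def
  by (auto intro!: sums_add sums_mult borel_measurable_add borel_measurable_times)

lemma unit_head_weights:
  "(\<lambda>j \<omega>. if j = n then 1 else 0) \<in> head_weights M n"
  unfolding head_weights_def weights_def
  using sums_single[of n "\<lambda>_. 1::real"]
  by (auto intro!: exI[of _ "Suc n"])

text \<open>
  The modification that compares consecutive near-minimisers: averaging on an event \<open>A\<close> only. The
  weight \<open>v\<close> vanishes at \<open>n\<close>, but the half of \<open>w\<close> keeps the coefficient there positive.
\<close>

lemma head_weights_paste:
  assumes w: "w \<in> head_weights M n" and v: "v \<in> head_weights M (Suc n)" and A: "A \<in> sets M"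
  shows "(\<lambda>j \<omega>. if \<omega> \<in> A then (w j \<omega> + v j \<omega>) / 2 else w j \<omega>) \<in> head_weights M n"
proof -
  obtain N N' where N: "\<forall>j\<ge>N. \<forall>\<omega>. w j \<omega> = 0" "\<forall>j\<ge>N'. \<forall>\<omega>. v j \<omega> = 0"
    using w v by (auto simp: head_weights_def)
  have [measurable]: "w j \<in> borel_measurable M" "v j \<in> borel_measurable M" for j
    using w v by (auto simp: head_weights_def weights_def)
  have [measurable]: "A \<in> sets M" by fact
  have nn: "0 \<le> w j \<omega>" "0 \<le> v j \<omega>" for j \<omega> using w v by (auto simp: head_weights_def weights_def)
  have pos: "0 < w n \<omega>" for \<omega> using w by (auto simp: head_weights_def)
  have sums: "(\<lambda>j. w j \<omega>) sums 1" "(\<lambda>j. v j \<omega>) sums 1" for \<omega>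
    using w v by (auto simp: head_weights_def weights_def)
  have "(\<lambda>j. (w j \<omega> + v j \<omega>) / 2) sums ((1 + 1) / 2)" for \<omega>
    by (intro sums_divide sums_add sums)
  then have "(\<lambda>j. if \<omega> \<in> A then (w j \<omega> + v j \<omega>) / 2 else w j \<omega>) sums 1" for \<omega>
    using sums(1) by (cases "\<omega> \<in> A") auto
  moreover have "(\<lambda>\<omega>. if \<omega> \<in> A then (w j \<omega> + v j \<omega>) / 2 else w j \<omega>) \<in> borel_measurable M" for j
    by measurable
  moreover have "\<exists>K. \<forall>j\<ge>K. \<forall>\<omega>. (if \<omega> \<in> A then (w j \<omega> + v j \<omega>) / 2 else w j \<omega>) = 0"
    using N by (intro exI[of _ "max N N'"]) auto
  ultimately show ?thesis
    using w v nn pos unfolding head_weights_def weights_def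
    by (auto simp: add_pos_nonneg)
qed

locale L0_bounded_sequence = prob_space M for M :: "'a measure" +
  fixes E :: "'e set" and \<epsilon> :: "'a \<Rightarrow> real" and f :: "nat \<Rightarrow> 'e \<Rightarrow> 'a \<Rightarrow> real"
  assumes E_nonempty: "E \<noteq> {}"
    and \<epsilon>_pos: "\<epsilon> \<in> L0_pos M"
    and f_ball: "\<And>n x. x \<in> E \<Longrightarrow> f n x \<in> L0_ball M \<epsilon>"
begin

definition mix :: "(nat \<Rightarrow> 'a \<Rightarrow> real) \<Rightarrow> 'e \<Rightarrow> 'a \<Rightarrow> real" where
  "mix a x \<omega> = (\<Sum>j. a j \<omega> * f j x \<omega>)"

definition top_value :: "(nat \<Rightarrow> 'a \<Rightarrow> real) \<Rightarrow> 'a \<Rightarrow> real" where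
  "top_value a \<omega> = real_of_ereal (ess_sup M ((\<lambda>x \<omega>. ereal (mix a x \<omega>)) ` E) \<omega>)"

lemma f_measurable: "x \<in> E \<Longrightarrow> f n x \<in> borel_measurable M"
  using f_ball by (auto simp: L0_ball_def L0_def)

lemma \<epsilon>_measurable [measurable]: "\<epsilon> \<in> borel_measurable M"
  using \<epsilon>_pos by (auto simp: L0_pos_def L0_def)

lemma AE_\<epsilon>_pos: "AE \<omega> in M. 0 < \<epsilon> \<omega>"
  using \<epsilon>_pos by (auto simp: L0_pos_def)

lemma AE_f_bounded: "x \<in> E \<Longrightarrow> AE \<omega> in M. \<forall>j. \<bar>f j x \<omega>\<bar> \<le> \<epsilon> \<omega>"
  using f_ball by (subst AE_all_countable) (auto simp: L0_ball_def)

lemma mix_measurable: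
  assumes "a \<in> weights M s" "x \<in> E"
  shows "mix a x \<in> borel_measurable M"
proof -
  have [measurable]: "a j \<in> borel_measurable M" "f j x \<in> borel_measurable M" for j
    using assms f_measurable by (auto simp: weights_def)
  show ?thesis unfolding mix_def[abs_def] by measurable
qed

lemma mix_family_L0bar:
  "a \<in> weights M s \<Longrightarrow> (\<lambda>x \<omega>. ereal (mix a x \<omega>)) ` E \<subseteq> L0bar M"
  using mix_measurable by (auto simp: L0bar_def)

lemma mix_bound:
  assumes "a \<in> weights M s" "x \<in> E"
  shows "AE \<omega> in M. \<bar>mix a x \<omega>\<bar> \<le> s * \<epsilon> \<omega>"
  using AE_f_bounded[OF assms(2)]
proof eventually_elim
  case (elim \<omega>)
  with assms(1) show ?case unfolding mix_def by (intro weighted_sum_bound(2)) (auto simp: weights_def)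
qed

lemma mix_add_scaled:
  assumes "a \<in> weights M s" "b \<in> weights M t" "x \<in> E"
  shows "AE \<omega> in M. mix (add_scaled a c b) x \<omega> = mix a x \<omega> + c * mix b x \<omega>"
  using AE_f_bounded[OF assms(3)]
proof eventually_elim
  case (elim \<omega>)
  have 1: "summable (\<lambda>j. a j \<omega> * f j x \<omega>)"
    using assms(1) elim by (intro weighted_sum_bound(1)[where e="\<epsilon> \<omega>"]) (auto simp: weights_def)
  have 2: "summable (\<lambda>j. b j \<omega> * f j x \<omega>)"
    using assms(2) elim by (intro weighted_sum_bound(1)[where e="\<epsilon> \<omega>"]) (auto simp: weights_def)
  have "(\<Sum>j. a j \<omega> * f j x \<omega> + c * (b j \<omega> * f j x \<omega>)) = mix a x \<omega> + c * mix b x \<omega>"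
    using suminf_add[OF 1 summable_mult[OF 2, of c]] suminf_mult[OF 2, of c] by (simp add: mix_def)
  then show ?case by (simp add: mix_def add_scaled_def algebra_simps)
qed

lemma top_value_measurable:
  assumes "a \<in> weights M s"
  shows "top_value a \<in> borel_measurable M"
proof -
  have [measurable]: "ess_sup M ((\<lambda>x \<omega>. ereal (mix a x \<omega>)) ` E) \<in> borel_measurable M"
    using ess_sup_L0bar[OF mix_family_L0bar[OF assms]] by (simp add: L0bar_def)
  show ?thesis unfolding top_value_def[abs_def] by measurable
qed

text \<open>
  Total mass one bounds the essential supremum by \<open>\<epsilon>\<close>, and a point of \<open>E\<close> bounds it from
  below, so taking the real part in \<open>top_value\<close> loses nothing.
\<close>

lemma ess_sup_eq_top_value:
  assumes a: "a \<in> weights M 1"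
  shows "AE \<omega> in M. ess_sup M ((\<lambda>x \<omega>. ereal (mix a x \<omega>)) ` E) \<omega> = ereal (top_value a \<omega>)
    \<and> \<bar>top_value a \<omega>\<bar> \<le> \<epsilon> \<omega>"
proof -
  let ?Q = "ess_sup M ((\<lambda>x \<omega>. ereal (mix a x \<omega>)) ` E)"
  obtain x where x: "x \<in> E" using E_nonempty by auto
  have "AE \<omega> in M. ereal (mix a x \<omega>) \<le> ?Q \<omega>"
    using x by (intro ess_sup_upper[OF mix_family_L0bar[OF a]]) auto
  moreover have "AE \<omega> in M. ?Q \<omega> \<le> ereal (\<epsilon> \<omega>)"
  proof (rule ess_sup_least[OF mix_family_L0bar[OF a]])
    fix X assume "X \<in> (\<lambda>x \<omega>. ereal (mix a x \<omega>)) ` E"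
    then obtain y where y: "y \<in> E" "X = (\<lambda>\<omega>. ereal (mix a y \<omega>))" by auto
    show "AE \<omega> in M. X \<omega> \<le> ereal (\<epsilon> \<omega>)"
      using mix_bound[OF a y(1)] by eventually_elim (auto simp: y(2))
  qed (auto simp: L0bar_def)
  ultimately show ?thesis using mix_bound[OF a x]
  proof eventually_elim
    case (elim \<omega>)
    then show ?case unfolding top_value_def by (cases "?Q \<omega>") auto
  qed
qed

lemma top_value_bound:
  assumes "a \<in> weights M 1"
  shows "AE \<omega> in M. \<bar>top_value a \<omega>\<bar> \<le> \<epsilon> \<omega>"
  using ess_sup_eq_top_value[OF assms] by eventually_elim auto

lemma mix_le_top_value:
  assumes a: "a \<in> weights M 1" and x: "x \<in> E"
  shows "AE \<omega> in M. mix a x \<omega> \<le> top_value a \<omega>"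
proof -
  have "AE \<omega> in M. ereal (mix a x \<omega>) \<le> ess_sup M ((\<lambda>x \<omega>. ereal (mix a x \<omega>)) ` E) \<omega>"
    using x by (intro ess_sup_upper[OF mix_family_L0bar[OF a]]) auto
  then show ?thesis using ess_sup_eq_top_value[OF a] by eventually_elim auto
qed

text \<open>
  An upper bound valid on an event only becomes a global one when it is set to \<open>\<infinity>\<close> elsewhere.
\<close>

lemma top_value_least_on:
  assumes a: "a \<in> weights M 1" and A: "A \<in> sets M" and Y: "Y \<in> borel_measurable M"
    and le: "\<And>x. x \<in> E \<Longrightarrow> AE \<omega> in M. \<omega> \<in> A \<longrightarrow> mix a x \<omega> \<le> Y \<omega>"
  shows "AE \<omega> in M. \<omega> \<in> A \<longrightarrow> top_value a \<omega> \<le> Y \<omega>"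
proof -
  let ?Q = "ess_sup M ((\<lambda>x \<omega>. ereal (mix a x \<omega>)) ` E)"
  let ?Z = "\<lambda>\<omega>. if \<omega> \<in> A then ereal (Y \<omega>) else \<infinity>"
  have [measurable]: "A \<in> sets M" "Y \<in> borel_measurable M" by fact+
  have "AE \<omega> in M. ?Q \<omega> \<le> ?Z \<omega>"
  proof (rule ess_sup_least[OF mix_family_L0bar[OF a]])
    show "?Z \<in> L0bar M" unfolding L0bar_def by measurable
    fix X assume "X \<in> (\<lambda>x \<omega>. ereal (mix a x \<omega>)) ` E"
    then obtain y where y: "y \<in> E" "X = (\<lambda>\<omega>. ereal (mix a y \<omega>))" by auto
    show "AE \<omega> in M. X \<omega> \<le> ?Z \<omega>"
      using le[OF y(1)] by eventually_elim (auto simp: y(2))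
  qed
  then show ?thesis using ess_sup_eq_top_value[OF a] by eventually_elim auto
qed

text \<open>
  On an event where the weights agree, \<open>top_value b\<close> is an upper bound for the mixtures of \<open>a\<close>.
  Exchanging the roles, \<open>top_value\<close> of weights pasted along an event is the pasting of their top values.
\<close>

lemma top_value_local:
  assumes a: "a \<in> weights M 1" and b: "b \<in> weights M 1" and A: "A \<in> sets M"
    and eq: "\<And>j \<omega>. \<omega> \<in> A \<Longrightarrow> a j \<omega> = b j \<omega>"
  shows "AE \<omega> in M. \<omega> \<in> A \<longrightarrow> top_value a \<omega> \<le> top_value b \<omega>"
proof (rule top_value_least_on[OF a A top_value_measurable[OF b]])
  fix x assume "x \<in> E"
  from mix_le_top_value[OF b this]
  show "AE \<omega> in M. \<omega> \<in> A \<longrightarrow> mix a x \<omega> \<le> top_value b \<omega>"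
    by eventually_elim (auto simp: mix_def eq)
qed

section \<open>Near-minimisers of the mean\<close>

definition mean_top :: "(nat \<Rightarrow> 'a \<Rightarrow> real) \<Rightarrow> real" where
  "mean_top a = (\<integral>\<omega>. top_value a \<omega> / \<epsilon> \<omega> \<partial>M)"

lemma top_value_ratio_bound:
  assumes "a \<in> weights M 1"
  shows "AE \<omega> in M. \<bar>top_value a \<omega> / \<epsilon> \<omega>\<bar> \<le> 1"
  using top_value_bound[OF assms] AE_\<epsilon>_pos by eventually_elim auto

lemma integrable_top_value_ratio:
  assumes "a \<in> weights M 1"
  shows "integrable M (\<lambda>\<omega>. top_value a \<omega> / \<epsilon> \<omega>)"
proof -
  have [measurable]: "top_value a \<in> borel_measurable M" using top_value_measurable[OF assms] .
  show ?thesis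
    using top_value_ratio_bound[OF assms] by (intro integrable_const_bound[where B=1]) auto
qed

lemma mean_top_lower:
  assumes "a \<in> weights M 1"
  shows "- 1 \<le> mean_top a"
proof -
  have "(\<integral>\<omega>. - 1 \<partial>M) \<le> mean_top a" unfolding mean_top_def
    using top_value_ratio_bound[OF assms]
    by (intro integral_mono_AE integrable_top_value_ratio assms)
      (auto elim!: eventually_mono simp: abs_le_iff simp del: abs_divide)
  then show ?thesis by (simp add: prob_space)
qed

lemma near_minimiser_exists:
  assumes W: "W \<noteq> {}" "F ` W \<subseteq> weights M 1" and e: "0 < e"
  shows "\<exists>w\<in>W. \<forall>v\<in>W. mean_top (F w) \<le> mean_top (F v) + e"
proof -
  let ?I = "\<lambda>w. mean_top (F w)"
  have bdd: "bdd_below (?I ` W)" using mean_top_lower W(2) by (intro bdd_belowI2[where m="-1"]) auto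
  obtain w where w: "w \<in> W" "?I w < Inf (?I ` W) + e"
    using cInf_lessD[of "?I ` W" "Inf (?I ` W) + e"] W(1) e by auto
  have "Inf (?I ` W) \<le> ?I v" if "v \<in> W" for v using bdd that by (intro cInf_lower) auto
  then show ?thesis using w by (intro bexI[of _ w]) force+
qed

text \<open>
  The pasted competitor \<open>u\<close> switches from \<open>w\<close> to the average of \<open>w\<close> and \<open>v\<close> exactly where
  \<open>G'\<close> has the smaller top value. By locality its top value is at most the minimum of those of \<open>G\<close>
  and \<open>G'\<close>, so near-minimality of \<open>w\<close> in the mean bounds the mean of the positive part of their
  difference.
\<close>

lemma excess_bound:
  assumes b: "b \<in> weights M (1 - (1/2)^n)"
    and w: "w \<in> head_weights M n" and v: "v \<in> head_weights M (Suc n)"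
    and min: "\<forall>u\<in>head_weights M n. mean_top (add_scaled b ((1/2)^n) w)
      \<le> mean_top (add_scaled b ((1/2)^n) u) + e"
  defines "G \<equiv> add_scaled b ((1/2)^n) w"
    and "G' \<equiv> add_scaled (add_scaled b ((1/2)^Suc n) w) ((1/2)^Suc n) v"
  shows "(\<integral>\<^sup>+\<omega>. ennreal (max 0 (top_value G \<omega> - top_value G' \<omega>) / \<epsilon> \<omega>) \<partial>M) \<le> ennreal e"
proof -
  have w1: "w \<in> weights M 1" and v1: "v \<in> weights M 1" using w v by (auto simp: head_weights_def)
  have G: "G \<in> weights M 1" unfolding G_def by (rule weights_add_scaled[OF b w1]) auto
  have G': "G' \<in> weights M 1" unfolding G'_def
    by (rule weights_add_scaled[OF weights_add_scaled[OF b w1 _ refl] v1]) auto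
  have [measurable]: "top_value G \<in> borel_measurable M" "top_value G' \<in> borel_measurable M"
    using top_value_measurable G G' by auto
  define A where "A = {\<omega> \<in> space M. top_value G' \<omega> < top_value G \<omega>}"
  have A[measurable]: "A \<in> sets M" unfolding A_def by measurable
  define u where "u = (\<lambda>j \<omega>. if \<omega> \<in> A then (w j \<omega> + v j \<omega>) / 2 else w j \<omega>)"
  have u: "u \<in> head_weights M n" unfolding u_def using head_weights_paste[OF w v A] .
  then have u1: "u \<in> weights M 1" by (auto simp: head_weights_def)
  define U where "U = add_scaled b ((1/2)^n) u"
  have U: "U \<in> weights M 1" unfolding U_def by (rule weights_add_scaled[OF b u1]) auto
  have "AE \<omega> in M. \<omega> \<in> A \<longrightarrow> top_value U \<omega> \<le> top_value G' \<omega>"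
    by (rule top_value_local[OF U G' A]) (auto simp: U_def u_def G'_def add_scaled_def field_simps)
  moreover have "AE \<omega> in M. \<omega> \<in> space M - A \<longrightarrow> top_value U \<omega> \<le> top_value G \<omega>"
    by (rule top_value_local[OF U G]) (auto simp: U_def u_def G_def add_scaled_def)
  ultimately have le: "AE \<omega> in M. max 0 (top_value G \<omega> - top_value G' \<omega>) / \<epsilon> \<omega>
      \<le> top_value G \<omega> / \<epsilon> \<omega> - top_value U \<omega> / \<epsilon> \<omega>
      \<and> 0 \<le> top_value G \<omega> / \<epsilon> \<omega> - top_value U \<omega> / \<epsilon> \<omega>"
    using AE_\<epsilon>_pos AE_space
  proof eventually_elim
    case (elim \<omega>)
    have "max 0 (top_value G \<omega> - top_value G' \<omega>) \<le> top_value G \<omega> - top_value U \<omega>"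
      using elim by (cases "\<omega> \<in> A") (auto simp: A_def)
    moreover from this have "0 \<le> top_value G \<omega> - top_value U \<omega>" by linarith
    ultimately show ?case using elim by (auto simp: divide_right_mono diff_divide_distrib[symmetric])
  qed
  note int = integrable_top_value_ratio[OF G] integrable_top_value_ratio[OF U]
  have "(\<integral>\<^sup>+\<omega>. ennreal (max 0 (top_value G \<omega> - top_value G' \<omega>) / \<epsilon> \<omega>) \<partial>M)
      \<le> (\<integral>\<^sup>+\<omega>. ennreal (top_value G \<omega> / \<epsilon> \<omega> - top_value U \<omega> / \<epsilon> \<omega>) \<partial>M)"
    using le by (intro nn_integral_mono_AE) (auto elim!: eventually_mono intro: ennreal_leI)
  also have "\<dots> = ennreal (\<integral>\<omega>. top_value G \<omega> / \<epsilon> \<omega> - top_value U \<omega> / \<epsilon> \<omega> \<partial>M)"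
    using le int by (intro nn_integral_eq_integral) auto
  also have "(\<integral>\<omega>. top_value G \<omega> / \<epsilon> \<omega> - top_value U \<omega> / \<epsilon> \<omega> \<partial>M) = mean_top G - mean_top U"
    using int by (simp add: mean_top_def)
  also have "ennreal (mean_top G - mean_top U) \<le> ennreal e"
    using min u by (intro ennreal_leI) (auto simp: G_def U_def algebra_simps)
  finally show ?thesis .
qed


lemma near_minimising_sequence:
  assumes e: "\<And>n. 0 < e n"
  obtains B w where "B 0 = (\<lambda>j \<omega>. 0)" "\<And>n. B n \<in> weights M (1 - (1/2)^n)"
    "\<And>n. w n \<in> head_weights M n" "\<And>n. B (Suc n) = add_scaled (B n) ((1/2)^Suc n) (w n)"
    "\<And>n. \<forall>u\<in>head_weights M n. mean_top (add_scaled (B n) ((1/2)^n) (w n))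
      \<le> mean_top (add_scaled (B n) ((1/2)^n) u) + e n"
proof -
  let ?near = "\<lambda>n b w. \<forall>u\<in>head_weights M n. mean_top (add_scaled b ((1/2)^n) w)
      \<le> mean_top (add_scaled b ((1/2)^n) u) + e n"
  let ?P = "\<lambda>n b. b \<in> weights M (1 - (1/2)^n) \<and> (n = 0 \<longrightarrow> b = (\<lambda>j \<omega>. 0))"
  let ?Q = "\<lambda>n b b'. \<exists>w\<in>head_weights M n. ?near n b w \<and> b' = add_scaled b ((1/2)^Suc n) w"
  have "\<exists>B. \<forall>n. ?P n (B n) \<and> ?Q n (B n) (B (Suc n))"
  proof (rule dependent_nat_choice)
    show "\<exists>b. ?P 0 b" by (auto simp: weights_def)
    fix b n assume b: "?P n b"
    have "add_scaled b ((1/2)^n) u \<in> weights M 1" if "u \<in> head_weights M n" for u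
      using that b by (intro weights_add_scaled[of b _ _ u 1]) (auto simp: head_weights_def)
    then obtain w where w: "w \<in> head_weights M n" "?near n b w"
      using near_minimiser_exists[of "head_weights M n" "add_scaled b ((1/2)^n)" "e n"]
        unit_head_weights[of n M] e[of n] by auto
    have "add_scaled b ((1/2)^Suc n) w \<in> weights M (1 - (1/2)^Suc n)"
      using w b by (intro weights_add_scaled[of b _ _ w 1]) (auto simp: head_weights_def)
    with w show "\<exists>b'. ?P (Suc n) b' \<and> ?Q n b b'" by auto
  qed
  then obtain B where B: "\<And>n. ?P n (B n)" "\<And>n. ?Q n (B n) (B (Suc n))" by auto
  from B(2) obtain w where "\<And>n. w n \<in> head_weights M n \<and> ?near n (B n) (w n)
      \<and> B (Suc n) = add_scaled (B n) ((1/2)^Suc n) (w n)" by metis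
  with B(1) show thesis by (intro that[of B w]) auto
qed

end

section \<open>The limiting weights\<close>

text \<open>
  The \<open>j\<close>-th coefficient of \<open>B n\<close> no longer changes once \<open>n > j\<close>, since later \<open>w n\<close> vanish
  at \<open>j\<close>. Hence the limit \<open>h\<close> needs no infinite series. It dominates every \<open>B n\<close>, which forces its
  mass to be one, and the rescaled remainder \<open>r\<close> is a probability weight that lives on the indices
  from \<open>n\<close> on.
\<close>

lemma limit_weights_decompose:
  assumes B: "\<And>n. B n \<in> weights M (1 - (1/2)^n)"
    and w: "\<And>n. w n \<in> head_weights M n"
    and Suc: "\<And>n. B (Suc n) = add_scaled (B n) ((1/2)^Suc n) (w n)"
  defines "h \<equiv> \<lambda>j. B (Suc j) j"
  shows "\<exists>r\<in>weights M 1. h = add_scaled (B n) ((1/2)^n) r \<and> (\<forall>j<n. \<forall>\<omega>. r j \<omega> = 0)"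
proof -
  have wnn: "0 \<le> w n j \<omega>" and w0: "j < n \<Longrightarrow> w n j \<omega> = 0" for n j \<omega>
    using w[of n] by (auto simp: head_weights_def weights_def)
  have Bnn: "0 \<le> B n j \<omega>" and Bsums: "(\<lambda>j. B n j \<omega>) sums (1 - (1/2)^n)" for n j \<omega>
    using B[of n] by (auto simp: weights_def)
  have mono: "B n j \<omega> \<le> B m j \<omega>" if "n \<le> m" for n m j \<omega>
    using that by (rule lift_Suc_mono_le[rotated]) (auto simp: Suc add_scaled_def wnn)
  have stable: "B n j \<omega> = h j \<omega>" if "Suc j \<le> n" for n j \<omega>
    using that
  proof (induction n rule: dec_induct)
    case (step n)
    then show ?case using w0[of j n \<omega>] by (simp add: Suc add_scaled_def)
  qed (simp add: h_def)
  have le: "B n j \<omega> \<le> h j \<omega>" for n j \<omega>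
  proof (cases "Suc j \<le> n")
    case False
    then show ?thesis unfolding h_def by (intro mono) auto
  qed (simp add: stable)
  have hnn: "0 \<le> h j \<omega>" for j \<omega> using Bnn by (simp add: h_def)
  have partial: "(\<Sum>j<J. h j \<omega>) \<le> 1" for J \<omega>
  proof -
    have "(\<Sum>j<J. h j \<omega>) = (\<Sum>j<J. B J j \<omega>)" by (intro sum.cong) (auto simp: stable)
    also have "\<dots> \<le> (\<Sum>j. B J j \<omega>)" using Bsums Bnn by (intro sum_le_suminf) (auto simp: sums_iff)
    also have "\<dots> \<le> 1" using Bsums[of J \<omega>] by (simp add: sums_iff)
    finally show ?thesis .
  qed
  have hsum: "summable (\<lambda>j. h j \<omega>)" for \<omega>
    using hnn partial by (intro summableI_nonneg_bounded)
  have "(\<Sum>j. h j \<omega>) = 1" for \<omega>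
  proof (rule antisym)
    show "(\<Sum>j. h j \<omega>) \<le> 1" using hsum partial by (rule suminf_le_const)
    have "1 - (1/2)^n \<le> (\<Sum>j. h j \<omega>)" for n
      using suminf_le[of "\<lambda>j. B n j \<omega>" "\<lambda>j. h j \<omega>"] le Bsums[of n \<omega>] hsum by (simp add: sums_iff)
    moreover have "(\<lambda>n. 1 - (1/2)^n :: real) \<longlonglongrightarrow> 1 - 0"
      by (intro tendsto_intros LIMSEQ_power_zero) auto
    ultimately show "1 \<le> (\<Sum>j. h j \<omega>)" by (intro LIMSEQ_le_const2[of _ 1]) auto
  qed
  then have hsums: "(\<lambda>j. h j \<omega>) sums 1" for \<omega> using hsum by (simp add: sums_iff)
  define r where "r = (\<lambda>j \<omega>. 2^n * (h j \<omega> - B n j \<omega>))"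
  have "(\<lambda>j. r j \<omega>) sums (2^n * (1 - (1 - (1/2)^n)))" for \<omega>
    unfolding r_def by (intro sums_mult sums_diff hsums Bsums)
  then have "(\<lambda>j. r j \<omega>) sums 1" for \<omega> by (simp add: power_mult_distrib[symmetric])
  moreover have "r j \<in> borel_measurable M" for j
    using B unfolding r_def h_def weights_def by (intro borel_measurable_times borel_measurable_diff) auto
  ultimately have "r \<in> weights M 1" using le by (auto simp: weights_def r_def)
  moreover have "h = add_scaled (B n) ((1/2)^n) r"
  proof (intro ext)
    fix j \<omega>
    have "(1/2)^n * 2^n = (1::real)" by (simp add: power_divide)
    then have "(1/2)^n * (2^n * (h j \<omega> - B n j \<omega>)) = h j \<omega> - B n j \<omega>"
      by (metis mult.assoc mult_1)
    then show "h j \<omega> = add_scaled (B n) ((1/2)^n) r j \<omega>"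
      unfolding add_scaled_def r_def by linarith
  qed
  moreover have "\<forall>j<n. \<forall>\<omega>. r j \<omega> = 0" by (auto simp: r_def stable)
  ultimately show ?thesis by blast
qed

text \<open>
  The pointwise core. Let \<open>\<Delta> n\<close> be the sum of the \<open>d k\<close> with \<open>k \<ge> n\<close> and \<open>T n = 2^n * (H - c n)\<close>.
  The \<open>P n\<close> increase up to errors \<open>d n\<close>, so \<open>P n \<le> H + \<Delta> n\<close>; then \<open>2 * c (n+1) - c n \<le> P n\<close>
  reads \<open>T (n+1) \<ge> T n - 2^n * \<Delta> n\<close>. The accumulated loss is bounded by the sum of
  \<open>2^(k+1) * d k\<close>.
\<close>

lemma tail_averages_lower_bound:
  fixes P c d \<theta> :: "nat \<Rightarrow> real"
  assumes d: "\<And>k. 0 \<le> d k" "summable (\<lambda>k. 2^Suc k * d k)"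
    and step: "\<And>n. P n \<le> P (Suc n) + d n"
    and lim: "\<And>n. P n \<le> H + \<theta> n" "\<theta> \<longlonglongrightarrow> 0"
    and c: "\<And>n. 2 * c (Suc n) - c n \<le> P n" "c 0 = 0"
  shows "P 0 - (\<Sum>k. 2^Suc k * d k) \<le> 2^n * (H - c n)"
proof -
  have le: "d k \<le> 2^Suc k * d k" for k
  proof -
    have "(1::real) \<le> 2^Suc k" by (rule one_le_power) simp
    then have "1 * d k \<le> 2^Suc k * d k" using d(1) by (rule mult_right_mono)
    then show ?thesis by simp
  qed
  have sd: "summable d" using d le by (intro summable_comparison_test'[OF d(2), of 0]) auto
  define \<Delta> where "\<Delta> n = (\<Sum>k. d (k + n))" for n
  have sdn: "summable (\<lambda>k. d (k + n))" for n using sd by (simp add: summable_iff_shift)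
  have \<Delta>_Suc: "\<Delta> n = d n + \<Delta> (Suc n)" for n
    using suminf_split_head[OF sdn[of n]] by (simp add: \<Delta>_def)
  have PH: "P n \<le> H + \<Delta> n" for n
  proof -
    have "P n \<le> P (n + m) + (\<Sum>k<m. d (k + n))" for m
    proof (induction m)
      case (Suc m)
      then show ?case using step[of "n + m"] by (simp add: add.commute)
    qed simp
    moreover have "(\<Sum>k<m. d (k + n)) \<le> \<Delta> n" for m
      unfolding \<Delta>_def using sdn d(1) by (intro sum_le_suminf) auto
    ultimately have "P n \<le> (H + \<theta> (n + m)) + \<Delta> n" for m
      using lim(1)[of "n + m"] by (meson add_mono order_trans)
    moreover have "(\<lambda>m. (H + \<theta> (n + m)) + \<Delta> n) \<longlonglongrightarrow> (H + 0) + \<Delta> n"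
      using LIMSEQ_ignore_initial_segment[OF lim(2), of n]
      by (intro tendsto_intros) (simp add: add.commute)
    ultimately show ?thesis by (intro LIMSEQ_le_const[of _ "H + \<Delta> n"]) auto
  qed
  \<comment> \<open>The loss is recorded in the form that the step reproduces exactly: the two terms \<open>2^n * \<Delta> n\<close>
      add up to \<open>2^(n+1) * \<Delta> n = 2^(n+1) * d n + 2^(n+1) * \<Delta> (n+1)\<close>.\<close>
  have main: "P 0 - (\<Sum>k<n. 2^Suc k * d k) - 2^n * \<Delta> n \<le> 2^n * (H - c n)" for n
  proof (induction n)
    case 0
    then show ?case using PH[of 0] c(2) by simp
  next
    case (Suc n)
    have "2^n * (2 * c (Suc n) - c n) \<le> 2^n * (H + \<Delta> n)"
      using c(1)[of n] PH[of n] by (intro mult_left_mono) auto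
    then show ?case using Suc \<Delta>_Suc[of n] by (simp add: algebra_simps)
  qed
  have "2^n * \<Delta> n = (\<Sum>k. 2^n * d (k + n))" unfolding \<Delta>_def by (rule suminf_mult[OF sdn, symmetric])
  also have "\<dots> \<le> (\<Sum>k. 2^Suc (k + n) * d (k + n))"
    using d sdn by (intro suminf_le summable_mult summable_ignore_initial_segment[OF d(2)] mult_right_mono)
      (auto simp: power_increasing intro: order_trans[OF power_increasing[of n "Suc (_ + n)"]])
  finally have "2^n * \<Delta> n \<le> (\<Sum>k. 2^Suc (k + n) * d (k + n))" .
  with main[of n] suminf_split_initial_segment[OF d(2), of n] show ?thesis by simp
qed

section \<open>The inequality\<close>

context L0_bounded_sequence
begin

lemma convex_hull_family_L0bar:
  assumes "g \<in> L0_convex_hull M (range f)"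
  shows "(\<lambda>x \<omega>. ereal (g x \<omega>)) ` E \<subseteq> L0bar M"
proof -
  obtain I :: "nat set" and Y k where g: "g = (\<lambda>x \<omega>. \<Sum>i\<in>I. Y i \<omega> * k i x \<omega>)"
    and k: "\<forall>i\<in>I. k i \<in> range f" and Y: "\<forall>i\<in>I. Y i \<in> L0_nonneg M"
    using assms unfolding L0_convex_hull_def by blast
  have "(\<lambda>\<omega>. ereal (g x \<omega>)) \<in> borel_measurable M" if "x \<in> E" for x
  proof -
    have "k i x \<in> borel_measurable M" "Y i \<in> borel_measurable M" if "i \<in> I" for i
      using k Y f_measurable[OF \<open>x \<in> E\<close>] that by (auto simp: L0_nonneg_def L0_def)
    then show ?thesis unfolding g
      by (intro borel_measurable_ereal borel_measurable_sum borel_measurable_times) auto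
  qed
  then show ?thesis by (auto simp: L0bar_def)
qed

lemma ess_inf_hull_le_top_value:
  assumes w: "w \<in> head_weights M n"
  shows "AE \<omega> in M. ess_inf M ((\<lambda>g. ess_sup M ((\<lambda>x \<omega>. ereal (g x \<omega>)) ` E))
      ` L0_convex_hull M (range f)) \<omega> \<le> ereal (top_value w \<omega>)"
proof -
  have w1: "w \<in> weights M 1" using w by (auto simp: head_weights_def)
  obtain N where N: "\<And>j \<omega>. j \<ge> N \<Longrightarrow> w j \<omega> = 0" using w unfolding head_weights_def by blast
  have "mix w = (\<lambda>x \<omega>. \<Sum>j\<in>{..<N}. w j \<omega> * f j x \<omega>)"
    unfolding mix_def[abs_def] using N by (intro ext suminf_finite) auto
  moreover have "(\<Sum>j<N. w j \<omega>) = 1" for \<omega>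
    using w1 N suminf_finite[of "{..<N}" "\<lambda>j. w j \<omega>"] by (auto simp: weights_def sums_iff)
  ultimately have "mix w \<in> L0_convex_hull M (range f)"
    using w1 unfolding L0_convex_hull_def
    by (intro CollectI exI[of _ "{..<N}"] exI[of _ w] exI[of _ f])
      (auto simp: weights_def L0_nonneg_def L0_def)
  then have "AE \<omega> in M. ess_inf M ((\<lambda>g. ess_sup M ((\<lambda>x \<omega>. ereal (g x \<omega>)) ` E))
      ` L0_convex_hull M (range f)) \<omega> \<le> ess_sup M ((\<lambda>x \<omega>. ereal (mix w x \<omega>)) ` E) \<omega>"
    using ess_sup_L0bar[OF convex_hull_family_L0bar] by (intro ess_inf_lower) auto
  then show ?thesis using ess_sup_eq_top_value[OF w1] by eventually_elim auto
qed

text \<open>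
  The greedy construction for one tolerance \<open>\<eta>\<close>. Both sides of the inequality are related to
  \<open>top_value (G 0)\<close>: the weight \<open>G 0 = w 0\<close> belongs to the hull, and \<open>top_value (G 0) - D\<close> is a
  lower bound for all tail averages at the point \<open>z\<close>.
\<close>

lemma approximate_inequality:
  assumes S: "S \<subseteq> E"
    and attained: "\<And>a. a \<in> weights M 1 \<Longrightarrow> (\<And>j \<omega>. 0 < a j \<omega>) \<Longrightarrow>
      \<exists>z\<in>S. AE \<omega> in M. top_value a \<omega> = mix a z \<omega>"
    and \<eta>: "0 < \<eta>"
  shows "\<exists>D. D \<in> borel_measurable M \<and> (\<integral>\<^sup>+\<omega>. ennreal (D \<omega> / \<epsilon> \<omega>) \<partial>M) \<le> ennreal \<eta> \<and>
    (AE \<omega> in M. ess_inf M ((\<lambda>g. ess_sup M ((\<lambda>x \<omega>. ereal (g x \<omega>)) ` E)) ` L0_convex_hull M (range f)) \<omega>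
      \<le> ess_sup M ((\<lambda>x. ess_limsup M (\<lambda>n \<omega>. ereal (f n x \<omega>))) ` S) \<omega> + ereal (D \<omega>))"
proof -
  \<comment> \<open>The excess of step \<open>k\<close> enters \<open>D\<close> with factor \<open>2^(k+1)\<close>; with a tolerance of order \<open>4^-(k+1)\<close>
      the means of the terms of \<open>D / \<epsilon>\<close> add up to \<open>\<eta>\<close>.\<close>
  define e where "e k = \<eta> * (1/4)^Suc k" for k
  have e: "0 < e k" for k using \<eta> by (simp add: e_def)
  obtain B w where B0: "B 0 = (\<lambda>j \<omega>. 0)" and B: "\<And>n. B n \<in> weights M (1 - (1/2)^n)"
    and w: "\<And>n. w n \<in> head_weights M n"
    and BSuc: "\<And>n. B (Suc n) = add_scaled (B n) ((1/2)^Suc n) (w n)"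
    and min: "\<And>n. \<forall>u\<in>head_weights M n. mean_top (add_scaled (B n) ((1/2)^n) (w n))
      \<le> mean_top (add_scaled (B n) ((1/2)^n) u) + e n"
    using near_minimising_sequence[of e] e by metis
  have w1: "w n \<in> weights M 1" for n using w[of n] by (auto simp: head_weights_def)
  define G where "G n = add_scaled (B n) ((1/2)^n) (w n)" for n
  have G: "G n \<in> weights M 1" for n unfolding G_def by (rule weights_add_scaled[OF B w1]) auto
  define P where "P n = top_value (G n)" for n
  have P_meas [measurable]: "P n \<in> borel_measurable M" for n
    unfolding P_def using top_value_measurable[OF G] .
  define d where "d n \<omega> = max 0 (P n \<omega> - P (Suc n) \<omega>)" for n \<omega>
  have d_meas [measurable]: "d n \<in> borel_measurable M" for n unfolding d_def[abs_def] by measurable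
  have d_nn: "0 \<le> d n \<omega>" for n \<omega> by (simp add: d_def)
  have d_int: "(\<integral>\<^sup>+\<omega>. ennreal (d n \<omega> / \<epsilon> \<omega>) \<partial>M) \<le> ennreal (e n)" for n
    using excess_bound[OF B w w min, of n] by (simp add: d_def P_def G_def BSuc)
  define D where "D \<omega> = (\<Sum>k. 2^Suc k * d k \<omega>)" for \<omega>
  have D_meas [measurable]: "D \<in> borel_measurable M" unfolding D_def[abs_def] by measurable

  have "(\<integral>\<^sup>+\<omega>. (\<Sum>k. ennreal (2^Suc k * d k \<omega> / \<epsilon> \<omega>)) \<partial>M)
      = (\<Sum>k. \<integral>\<^sup>+\<omega>. ennreal (2^Suc k * d k \<omega> / \<epsilon> \<omega>) \<partial>M)"
    by (intro nn_integral_suminf) measurable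
  also have "\<dots> \<le> (\<Sum>k. ennreal (\<eta> * (1/2)^Suc k))"
  proof (intro suminf_le summableI allI)
    fix k
    have "(\<integral>\<^sup>+\<omega>. ennreal (2^Suc k * d k \<omega> / \<epsilon> \<omega>) \<partial>M)
        = (\<integral>\<^sup>+\<omega>. ennreal (2^Suc k) * ennreal (d k \<omega> / \<epsilon> \<omega>) \<partial>M)"
      by (simp add: ennreal_mult'[symmetric])
    also have "\<dots> = ennreal (2^Suc k) * (\<integral>\<^sup>+\<omega>. ennreal (d k \<omega> / \<epsilon> \<omega>) \<partial>M)"
      by (intro nn_integral_cmult) measurable
    also have "\<dots> \<le> ennreal (2^Suc k) * ennreal (e k)" by (intro mult_left_mono d_int) auto
    also have "\<dots> = ennreal (2^Suc k * e k)" using e[of k] by (simp add: ennreal_mult'[symmetric])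
    also have "2^Suc k * e k = \<eta> * (2 * (1/4))^Suc k"
      unfolding e_def power_mult_distrib by (simp add: mult_ac)
    finally show "(\<integral>\<^sup>+\<omega>. ennreal (2^Suc k * d k \<omega> / \<epsilon> \<omega>) \<partial>M) \<le> ennreal (\<eta> * (1/2)^Suc k)" by simp
  qed
  also have "\<dots> = ennreal \<eta>"
    using sums_mult[OF power_half_series, of \<eta>] \<eta> by (intro suminf_ennreal_eq) auto
  finally have sum_int: "(\<integral>\<^sup>+\<omega>. (\<Sum>k. ennreal (2^Suc k * d k \<omega> / \<epsilon> \<omega>)) \<partial>M) \<le> ennreal \<eta>" .
  then have "(\<integral>\<^sup>+\<omega>. (\<Sum>k. ennreal (2^Suc k * d k \<omega> / \<epsilon> \<omega>)) \<partial>M) \<noteq> \<infinity>"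
    using neq_top_trans[OF ennreal_neq_top] by (simp add: infinity_ennreal_def)
  then have "AE \<omega> in M. (\<Sum>k. ennreal (2^Suc k * d k \<omega> / \<epsilon> \<omega>)) \<noteq> \<infinity>"
    by (rule nn_integral_PInf_AE[rotated]) measurable
  then have D_sum: "AE \<omega> in M. summable (\<lambda>k. 2^Suc k * d k \<omega>) \<and>
      ennreal (D \<omega> / \<epsilon> \<omega>) = (\<Sum>k. ennreal (2^Suc k * d k \<omega> / \<epsilon> \<omega>))"
    using AE_\<epsilon>_pos
  proof eventually_elim
    case (elim \<omega>)
    have s: "summable (\<lambda>k. 2^Suc k * d k \<omega> / \<epsilon> \<omega>)"
      using elim d_nn by (intro summable_suminf_not_top) auto
    have s': "summable (\<lambda>k. 2^Suc k * d k \<omega>)"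
      using summable_mult2[OF s, of "\<epsilon> \<omega>"] elim by simp
    have "D \<omega> / \<epsilon> \<omega> = (\<Sum>k. 2^Suc k * d k \<omega> / \<epsilon> \<omega>)"
      unfolding D_def using suminf_divide[OF s'] by metis
    then show ?case using s s' elim d_nn by (simp add: suminf_ennreal2)
  qed
  have D_int: "(\<integral>\<^sup>+\<omega>. ennreal (D \<omega> / \<epsilon> \<omega>) \<partial>M) \<le> ennreal \<eta>"
  proof -
    have "(\<integral>\<^sup>+\<omega>. ennreal (D \<omega> / \<epsilon> \<omega>) \<partial>M) = (\<integral>\<^sup>+\<omega>. (\<Sum>k. ennreal (2^Suc k * d k \<omega> / \<epsilon> \<omega>)) \<partial>M)"
      using D_sum by (intro nn_integral_cong_AE) (auto elim!: eventually_mono)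
    with sum_int show ?thesis by simp
  qed

  define h where "h = (\<lambda>j. B (Suc j) j)"
  have "\<exists>r\<in>weights M 1. h = add_scaled (B n) ((1/2)^n) r \<and> (\<forall>j<n. \<forall>\<omega>. r j \<omega> = 0)" for n
    unfolding h_def by (rule limit_weights_decompose[OF B w BSuc])
  then obtain r where r: "\<And>n. r n \<in> weights M 1" "\<And>n. h = add_scaled (B n) ((1/2)^n) (r n)"
    "\<And>n j \<omega>. j < n \<Longrightarrow> r n j \<omega> = 0" by metis
  have h: "h \<in> weights M 1"
    using weights_add_scaled[OF B r(1), of "(1/2)^0" 1 0] r(2)[of 0] by simp
  have h_pos: "0 < h j \<omega>" for j \<omega>
  proof -
    have "0 < w j j \<omega>" "0 \<le> B j j \<omega>" using w[of j] B[of j] by (auto simp: head_weights_def weights_def)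
    then show ?thesis by (simp add: h_def BSuc add_scaled_def add_nonneg_pos)
  qed
  obtain z where z: "z \<in> S" and max: "AE \<omega> in M. top_value h \<omega> = mix h z \<omega>"
    using attained[OF h h_pos] by auto
  have zE: "z \<in> E" using z S by auto

  \<comment> \<open>\<open>G n\<close> and \<open>h\<close> differ only in how they distribute the mass \<open>(1/2)^n\<close> that is missing from \<open>B n\<close>.\<close>
  have P_le_h: "AE \<omega> in M. P n \<omega> \<le> top_value h \<omega> + 2 * (1/2)^n * \<epsilon> \<omega>" for n
  proof -
    have hm: "(\<lambda>\<omega>. top_value h \<omega> + 2 * (1/2)^n * \<epsilon> \<omega>) \<in> borel_measurable M"
      using top_value_measurable[OF h] by measurable
    have "AE \<omega> in M. \<omega> \<in> space M \<longrightarrow> top_value (G n) \<omega> \<le> top_value h \<omega> + 2 * (1/2)^n * \<epsilon> \<omega>"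
    proof (rule top_value_least_on[OF G sets.top hm])
      fix x assume x: "x \<in> E"
      have "AE \<omega> in M. mix h x \<omega> = mix (B n) x \<omega> + (1/2)^n * mix (r n) x \<omega>"
        using mix_add_scaled[OF B[of n] r(1)[of n] x, of "(1/2)^n"] r(2)[of n] by simp
      with mix_le_top_value[OF h x] mix_add_scaled[OF B[of n] w1[of n] x, of "(1/2)^n"]
        mix_bound[OF w1[of n] x] mix_bound[OF r(1)[of n] x]
      show "AE \<omega> in M. \<omega> \<in> space M \<longrightarrow> mix (G n) x \<omega> \<le> top_value h \<omega> + 2 * (1/2)^n * \<epsilon> \<omega>"
      proof eventually_elim
        case (elim \<omega>)
        have "(1/2)^n * (mix (w n) x \<omega> - mix (r n) x \<omega>) \<le> (1/2)^n * (2 * \<epsilon> \<omega>)"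
          using elim by (intro mult_left_mono) auto
        then show ?case using elim by (simp add: G_def algebra_simps)
      qed
    qed
    then show ?thesis using AE_space by eventually_elim (simp add: P_def)
  qed

  have V: "AE \<omega> in M. \<forall>n. P 0 \<omega> - D \<omega> \<le> mix (r n) z \<omega>"
  proof -
    have 1: "AE \<omega> in M. \<forall>n. P n \<omega> \<le> top_value h \<omega> + 2 * (1/2)^n * \<epsilon> \<omega>"
      using P_le_h by (subst AE_all_countable) auto
    have 2: "AE \<omega> in M. \<forall>n. mix (G n) z \<omega> \<le> P n \<omega>"
      using mix_le_top_value[OF G zE] by (subst AE_all_countable) (auto simp: P_def)
    have 3: "AE \<omega> in M. \<forall>n. mix (G n) z \<omega> = mix (B n) z \<omega> + (1/2)^n * mix (w n) z \<omega>"
      using mix_add_scaled[OF B w1 zE] by (subst AE_all_countable) (auto simp: G_def)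
    have 4: "AE \<omega> in M. \<forall>n. mix (B (Suc n)) z \<omega> = mix (B n) z \<omega> + (1/2)^Suc n * mix (w n) z \<omega>"
      unfolding BSuc using mix_add_scaled[OF B w1 zE] by (subst AE_all_countable) blast
    have 5: "AE \<omega> in M. \<forall>n. mix h z \<omega> = mix (B n) z \<omega> + (1/2)^n * mix (r n) z \<omega>"
    proof (subst AE_all_countable, rule allI)
      fix n
      show "AE \<omega> in M. mix h z \<omega> = mix (B n) z \<omega> + (1/2)^n * mix (r n) z \<omega>"
        using mix_add_scaled[OF B[of n] r(1)[of n] zE, of "(1/2)^n"] r(2)[of n] by simp
    qed
    from 1 2 3 4 5 max D_sum show ?thesis
    proof eventually_elim
      case (elim \<omega>)
      show ?case
      proof
        fix n
        have "P 0 \<omega> - (\<Sum>k. 2^Suc k * d k \<omega>) \<le> 2^n * (mix h z \<omega> - mix (B n) z \<omega>)"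
        proof (rule tail_averages_lower_bound[where \<theta>="\<lambda>n. 2 * (1/2)^n * \<epsilon> \<omega>"])
          show "P n \<omega> \<le> P (Suc n) \<omega> + d n \<omega>" for n by (simp add: d_def)
          show "P n \<omega> \<le> mix h z \<omega> + 2 * (1/2)^n * \<epsilon> \<omega>" for n using elim by simp
          have "(\<lambda>n. 2 * (1/2)^n * \<epsilon> \<omega>) \<longlonglongrightarrow> 2 * 0 * \<epsilon> \<omega>"
            by (intro tendsto_intros LIMSEQ_power_zero) auto
          then show "(\<lambda>n. 2 * (1/2)^n * \<epsilon> \<omega>) \<longlonglongrightarrow> 0" by simp
          show "2 * mix (B (Suc n)) z \<omega> - mix (B n) z \<omega> \<le> P n \<omega>" for n
          proof -
            have "2 * mix (B (Suc n)) z \<omega> - mix (B n) z \<omega> = mix (G n) z \<omega>" using elim by simp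
            then show ?thesis using elim by simp
          qed
          show "mix (B 0) z \<omega> = 0" by (simp add: B0 mix_def)
        qed (use elim d_nn in auto)
        also have "2^n * (mix h z \<omega> - mix (B n) z \<omega>) = (2 * (1/2))^n * mix (r n) z \<omega>"
          using elim(5)[THEN spec, of n] unfolding power_mult_distrib by simp
        finally show "P 0 \<omega> - D \<omega> \<le> mix (r n) z \<omega>" by (simp add: D_def)
      qed
    qed
  qed

  let ?F = "\<lambda>x n \<omega>. ereal (f n x \<omega>)"
  have F: "?F x n \<in> L0bar M" if "x \<in> E" for x n using f_measurable[OF that] by (auto simp: L0bar_def)
  have "AE \<omega> in M. ereal (P 0 \<omega> - D \<omega>) \<le> ess_limsup M (?F z) \<omega>"
  proof (rule ess_limsup_greatest[OF F[OF zE]])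
    show "(\<lambda>\<omega>. ereal (P 0 \<omega> - D \<omega>)) \<in> L0bar M" unfolding L0bar_def by measurable
    show "AE \<omega> in M. \<forall>n K. (\<forall>j\<ge>n. ereal (f j z \<omega>) \<le> K) \<longrightarrow> ereal (P 0 \<omega> - D \<omega>) \<le> K"
      using V AE_f_bounded[OF zE]
    proof eventually_elim
      case (elim \<omega>)
      have "ereal (mix (r n) z \<omega>) \<le> K" if "\<forall>j\<ge>n. ereal (f j z \<omega>) \<le> K" for n K
        unfolding mix_def using r(1)[of n] r(3)[of _ n] elim that
        by (intro weighted_average_le[where n=n and e="\<epsilon> \<omega>"]) (auto simp: weights_def)
      then show ?case using elim by (meson ereal_less_eq(3) order_trans)
    qed
  qed
  moreover have "AE \<omega> in M. ess_limsup M (?F z) \<omega> \<le> ess_sup M ((\<lambda>x. ess_limsup M (?F x)) ` S) \<omega>"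
    using z S ess_limsup_L0bar[OF F] by (intro ess_sup_upper) auto
  moreover have "AE \<omega> in M. ess_inf M ((\<lambda>g. ess_sup M ((\<lambda>x \<omega>. ereal (g x \<omega>)) ` E))
      ` L0_convex_hull M (range f)) \<omega> \<le> ereal (P 0 \<omega>)"
  proof -
    have "G 0 = w 0" by (simp add: G_def B0 add_scaled_def)
    then show ?thesis using ess_inf_hull_le_top_value[OF w[of 0]] by (simp add: P_def)
  qed
  ultimately have "AE \<omega> in M. ess_inf M ((\<lambda>g. ess_sup M ((\<lambda>x \<omega>. ereal (g x \<omega>)) ` E))
      ` L0_convex_hull M (range f)) \<omega>
      \<le> ess_sup M ((\<lambda>x. ess_limsup M (\<lambda>n \<omega>. ereal (f n x \<omega>))) ` S) \<omega> + ereal (D \<omega>)"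
  proof eventually_elim
    case (elim \<omega>)
    have "ereal (P 0 \<omega>) = ereal (P 0 \<omega> - D \<omega>) + ereal (D \<omega>)" by simp
    also have "\<dots> \<le> ess_sup M ((\<lambda>x. ess_limsup M (?F x)) ` S) \<omega> + ereal (D \<omega>)"
      using elim by (intro add_right_mono) auto
    finally show ?case using elim by auto
  qed
  with D_meas D_int show ?thesis by blast
qed

end

text \<open>
  The infimum of a sequence of errors whose weighted means tend to zero has weighted mean zero, so it
  vanishes almost surely.
\<close>

lemma (in prob_space) AE_le_of_small_errors:
  fixes X L :: "'a \<Rightarrow> ereal" and \<epsilon> :: "'a \<Rightarrow> real"
  assumes \<epsilon>: "\<epsilon> \<in> borel_measurable M" "AE \<omega> in M. 0 < \<epsilon> \<omega>"
    and approx: "\<And>\<eta>. 0 < \<eta> \<Longrightarrow> \<exists>D. D \<in> borel_measurable M \<and>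
      (\<integral>\<^sup>+\<omega>. ennreal (D \<omega> / \<epsilon> \<omega>) \<partial>M) \<le> ennreal \<eta> \<and> (AE \<omega> in M. X \<omega> \<le> L \<omega> + ereal (D \<omega>))"
  shows "AE \<omega> in M. X \<omega> \<le> L \<omega>"
proof -
  have "\<exists>D. D \<in> borel_measurable M \<and> (\<integral>\<^sup>+\<omega>. ennreal (D \<omega> / \<epsilon> \<omega>) \<partial>M) \<le> ennreal (1 / Suc i) \<and>
      (AE \<omega> in M. X \<omega> \<le> L \<omega> + ereal (D \<omega>))" for i by (rule approx) simp
  then obtain D where D[measurable]: "\<And>i. D i \<in> borel_measurable M"
    and int: "\<And>i. (\<integral>\<^sup>+\<omega>. ennreal (D i \<omega> / \<epsilon> \<omega>) \<partial>M) \<le> ennreal (1 / Suc i)"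
    and le: "\<And>i. AE \<omega> in M. X \<omega> \<le> L \<omega> + ereal (D i \<omega>)" by metis
  note \<epsilon>(1)[measurable]
  have bound: "(\<integral>\<^sup>+\<omega>. (INF i. ennreal (D i \<omega> / \<epsilon> \<omega>)) \<partial>M) \<le> ennreal (1 / Suc i)" for i
    using nn_integral_mono[of M "\<lambda>\<omega>. INF i. ennreal (D i \<omega> / \<epsilon> \<omega>)" "\<lambda>\<omega>. ennreal (D i \<omega> / \<epsilon> \<omega>)"] int[of i]
    by (meson INF_lower UNIV_I order_trans)
  have "(\<lambda>i. ennreal (1 / Suc i)) \<longlonglongrightarrow> ennreal 0"
    using LIMSEQ_inverse_real_of_nat by (intro tendsto_ennrealI) (simp add: inverse_eq_divide)
  then have "(\<integral>\<^sup>+\<omega>. (INF i. ennreal (D i \<omega> / \<epsilon> \<omega>)) \<partial>M) \<le> ennreal 0"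
    using bound by (intro LIMSEQ_le_const) auto
  then have "(\<integral>\<^sup>+\<omega>. (INF i. ennreal (D i \<omega> / \<epsilon> \<omega>)) \<partial>M) = 0" by simp
  then have "AE \<omega> in M. (INF i. ennreal (D i \<omega> / \<epsilon> \<omega>)) = 0"
    by (subst (asm) nn_integral_0_iff_AE) measurable
  moreover have "AE \<omega> in M. \<forall>i. X \<omega> \<le> L \<omega> + ereal (D i \<omega>)" using le by (subst AE_all_countable) auto
  ultimately show ?thesis using \<epsilon>(2)
  proof eventually_elim
    case (elim \<omega>)
    show ?case
    proof (rule ereal_le_epsilon2)
      fix c :: real assume c: "0 < c"
      have "(INF i. ennreal (D i \<omega> / \<epsilon> \<omega>)) < ennreal (c / \<epsilon> \<omega>)" using elim c by simp
      then obtain i where "ennreal (D i \<omega> / \<epsilon> \<omega>) < ennreal (c / \<epsilon> \<omega>)" by (auto simp: INF_less_iff)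
      then have "D i \<omega> / \<epsilon> \<omega> < c / \<epsilon> \<omega>" by (meson ennreal_leI linorder_not_less)
      then have "D i \<omega> \<le> c" using elim by (simp add: divide_less_cancel)
      then have "L \<omega> + ereal (D i \<omega>) \<le> L \<omega> + ereal c" by (intro add_left_mono) simp
      with elim show "X \<omega> \<le> L \<omega> + ereal c" by (meson order_trans)
    qed
  qed
qed

theorem theorem2p1:
  fixes M :: "'a measure" and E S :: "'e set"
    and \<epsilon> :: "'a \<Rightarrow> real" and f :: "nat \<Rightarrow> 'e \<Rightarrow> 'a \<Rightarrow> real"
  assumes "prob_space M"
    and "\<epsilon> \<in> L0_pos M"
    and "\<And>n x. x \<in> E \<Longrightarrow> f n x \<in> L0_ball M \<epsilon>"
    and "S \<subseteq> E"
    and "\<And>Y :: nat \<Rightarrow> 'a \<Rightarrow> real.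
      (\<And>n. Y n \<in> L0_pos M) \<Longrightarrow> (AE \<omega> in M. (\<lambda>n. Y n \<omega>) sums 1) \<Longrightarrow>
      \<exists>z\<in>S. AE \<omega> in M.
        ess_sup M ((\<lambda>x \<omega>. ereal (\<Sum>n. Y n \<omega> * f n x \<omega>)) ` E) \<omega> = ereal (\<Sum>n. Y n \<omega> * f n z \<omega>)"
  shows "AE \<omega> in M.
    ess_sup M ((\<lambda>x. ess_limsup M (\<lambda>n \<omega>. ereal (f n x \<omega>))) ` S) \<omega>
      \<ge> ess_inf M ((\<lambda>g. ess_sup M ((\<lambda>x \<omega>. ereal (g x \<omega>)) ` E)) ` L0_convex_hull M (range f)) \<omega>"
proof -
  interpret prob_space M by fact
  \<comment> \<open>Any admissible weights yield a point of \<open>S\<close>, so \<open>E\<close> is nonempty.\<close>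
  have half: "(\<lambda>n. (1/2)^Suc n :: real) sums 1" by (rule power_half_series)
  have "E \<noteq> {}"
    using assms(5)[of "\<lambda>n \<omega>. (1/2)^Suc n"] half \<open>S \<subseteq> E\<close> by (auto simp: L0_pos_def L0_def)
  then interpret L0_bounded_sequence M E \<epsilon> f by unfold_locales (use assms in auto)
  show ?thesis
  proof (rule AE_le_of_small_errors[OF \<epsilon>_measurable AE_\<epsilon>_pos approximate_inequality[OF \<open>S \<subseteq> E\<close>]])
    fix a assume a: "a \<in> weights M 1" and pos: "\<And>j \<omega>. 0 < a j \<omega>"
    have "\<exists>z\<in>S. AE \<omega> in M. ess_sup M ((\<lambda>x \<omega>. ereal (mix a x \<omega>)) ` E) \<omega> = ereal (mix a z \<omega>)"
      unfolding mix_def using a pos by (intro assms(5)) (auto simp: weights_def L0_pos_def L0_def)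
    then show "\<exists>z\<in>S. AE \<omega> in M. top_value a \<omega> = mix a z \<omega>"
      by (auto simp: top_value_def elim!: eventually_mono)
  qed
qed

end
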